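(* Let $f(x)=x^x$ for $x>0$ and let $f^{(n)}$ denote its $n$-th derivative. Then for every integer $n\ge 1$ and every $x>0$, $$f^{(n)}(x)=f(x)\sum_{i=0}^{n}\Delta_i^{(n)}(x)\,(\ln x)^{n-i}.$$
   Context: The integers $\Omega(a,b)$, for $a\in\mathbb{Z}_{>0}$ and $b\in\mathbb{Z}_{\ge 0}$, are defined recursively by: $\Omega(a,0)=1$; $\Omega(a,b)=0$ if $b\ge a$ and $b\ge 1$; $\Omega(a,1)=\Omega(a-1,1)+1$ for $a\ge 2$; and $\Omega(a,b)=\Omega(a-1,b)-(b-1)\,\Omega(a-1,b-1)$ for $2\le b\le a-1$. For $n,k\in\mathbb{Z}_{\ge 0}$ and real $x>0$, the functions $\Delta_k^{(n)}(x)$ are defined recursively by: $\Delta_0^{(n)}(x)=1$; for $1\le k\le n$, $$\Delta_k^{(n)}(x)=\Delta_k^{(n-1)}(x)+\sum_{i=0}^{k-1}\Omega(n,i)\frac{1}{x^i}\Delta_{k-1-i}^{(n-1-i)}(x);$$ and $\Delta_k^{(n)}(x)=0$ if $k>n$. The superscript $(n)$ in $\Delta_k^{(n)}$ is an index, not a derivative. The convention $0^0=1$ is used for $(\ln x)^0$. *)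

theory Defs
  imports "HOL-Analysis.Analysis"
begin

(* Only a \<ge> 1 is meaningful. The recursive clauses are reached only for a \<ge> 2, so the
   incidental values at a = 0 (1 for b = 0, otherwise 0) influence no value with a \<ge> 1. *)
fun Omega :: "nat \<Rightarrow> nat \<Rightarrow> int" where
  "Omega a b =
    (if b = 0 then 1
     else if b \<ge> a then 0
     else if b = 1 then Omega (a - 1) 1 + 1
     else Omega (a - 1) b - (int b - 1) * Omega (a - 1) (b - 1))"

declare Omega.simps [simp del]

(* Delta n k x is \<Delta>\<^sub>k with superscript (n) at x. In the recursive clause 1 \<le> k \<le> n and i < k,
   so none of the natural-number subtractions truncates. *)
function Delta :: "nat \<Rightarrow> nat \<Rightarrow> real \<Rightarrow> real" where
  "Delta n k x =
    (if k = 0 then 1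
     else if k > n then 0
     else Delta (n - 1) k x
        + (\<Sum>i<k. of_int (Omega n i) * (1 / x ^ i) * Delta (n - 1 - i) (k - 1 - i) x))"
  by pat_completeness auto
termination
  by (relation "Wellfounded.measure (\<lambda>(n, k, x). n)") auto

declare Delta.simps [simp del]

definition self_power :: "real \<Rightarrow> real" where
  "self_power x = x powr x"

end

theory Submission
  imports Defs
begin

text \<open>
  Write \<open>f\<close> for the function \<open>x powr x\<close> and \<open>g i\<close> for the \<open>i\<close>-th derivative of \<open>ln x + 1\<close>.
  Since \<open>f' = g 0 * f\<close>, the Leibniz rule expresses the derivatives \<open>D n\<close> of \<open>f\<close> by
  \<open>D (n + 1) = (\<Sum>i\<le>n. (n choose i) * g i * D (n - i))\<close>.
  The numbers \<open>\<Omega>\<close> are just the numerators that occur in this expansion: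
  \<open>\<Omega>(n + 1, i) / x ^ i\<close> equals \<open>(n choose i) * g i\<close> for \<open>i \<ge> 1\<close> (lemma \<open>Omega_Suc_Suc\<close>), while for
  \<open>i = 0\<close> it accounts for the summand \<open>1\<close> of \<open>g 0 = ln x + 1\<close>. The remaining summand \<open>ln x\<close>
  raises every power of the logarithm by one, which is the term \<open>\<Delta>\<^sub>k\<close> with superscript \<open>n - 1\<close>
  in the recursion for \<open>\<Delta>\<close>. Thus that recursion is the Leibniz rule read off coefficientwise
  in powers of \<open>ln x\<close> (lemma \<open>Delta_sum_Suc\<close>).

  This yields the Leibniz recursion for the products \<open>F n = f * (\<Sum>i\<le>n. \<Delta>\<^sub>i * ln x ^ (n - i))\<close>.
  Together with \<open>F 0 = f\<close> and \<open>f' = F 1\<close> it forces each \<open>F (n + 1)\<close> to be the derivative of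
  \<open>F n\<close>, by strong induction (lemma \<open>Leibniz_recursion_DERIV\<close>).
\<close>

section \<open>Sequences satisfying the Leibniz recursion\<close>

text \<open>This is Pascal's rule: the step from \<open>n\<close> to \<open>n + 1\<close> in the Leibniz rule for iterated derivatives.\<close>

lemma Leibniz_sum_Suc:
  fixes g F :: "nat \<Rightarrow> 'a :: comm_semiring_1"
  shows "(\<Sum>i\<le>n. of_nat (n choose i) * (g (Suc i) * F (n - i) + g i * F (Suc n - i))) =
         (\<Sum>i\<le>Suc n. of_nat (Suc n choose i) * g i * F (Suc n - i))"
proof -
  have "(\<Sum>i\<le>n. of_nat (n choose i) * (g i * F (Suc n - i))) =
        (\<Sum>i\<le>Suc n. of_nat (n choose i) * (g i * F (Suc n - i)))"
    by (simp add: binomial_eq_0)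
  also have "\<dots> = g 0 * F (Suc n) + (\<Sum>i\<le>n. of_nat (n choose Suc i) * (g (Suc i) * F (n - i)))"
    by (subst sum.atMost_Suc_shift) simp
  finally have shifted: "(\<Sum>i\<le>n. of_nat (n choose i) * (g i * F (Suc n - i))) =
        g 0 * F (Suc n) + (\<Sum>i\<le>n. of_nat (n choose Suc i) * (g (Suc i) * F (n - i)))" .
  show ?thesis
    by (subst sum.atMost_Suc_shift)
       (simp add: distrib_left distrib_right sum.distrib shifted mult.assoc add_ac)
qed

text \<open>Differentiating the recursion for \<open>F (Suc n)\<close> involves only the derivatives of
  \<open>F 0, \<dots>, F n\<close>, which are known by induction, and Pascal's rule reassembles the result into the
  recursion for \<open>F (Suc (Suc n))\<close>.\<close>

lemma Leibniz_recursion_DERIV: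
  fixes g F :: "nat \<Rightarrow> 'a :: real_normed_field \<Rightarrow> 'a"
  assumes F_0: "\<And>x. x \<in> S \<Longrightarrow> (F 0 has_field_derivative F 1 x) (at x)"
    and g: "\<And>i x. x \<in> S \<Longrightarrow> (g i has_field_derivative g (Suc i) x) (at x)"
    and F_Suc: "\<And>n x. x \<in> S \<Longrightarrow> F (Suc n) x = (\<Sum>i\<le>n. of_nat (n choose i) * g i x * F (n - i) x)"
    and "open S" "x \<in> S"
  shows "(F n has_field_derivative F (Suc n) x) (at x)"
  using \<open>x \<in> S\<close>
proof (induction n arbitrary: x rule: less_induct)
  case (less n)
  show ?case
  proof (cases n)
    case 0
    with F_0[OF less.prems] show ?thesis by simp
  next
    case (Suc m)
    have F_deriv: "(F (m - i) has_field_derivative F (Suc m - i) x) (at x)" if "i \<le> m" for i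
      using less.IH[of "m - i" x] less.prems Suc that by (simp add: Suc_diff_le)
    have "((\<lambda>x. \<Sum>i\<le>m. of_nat (m choose i) * (g i x * F (m - i) x)) has_field_derivative
           (\<Sum>i\<le>m. of_nat (m choose i) * (g (Suc i) x * F (m - i) x + g i x * F (Suc m - i) x))) (at x)"
      using DERIV_mult[OF g[OF less.prems] F_deriv]
      by (intro DERIV_sum DERIV_cmult) (auto simp: algebra_simps)
    also have "(\<Sum>i\<le>m. of_nat (m choose i) * (g (Suc i) x * F (m - i) x + g i x * F (Suc m - i) x)) =
               F (Suc n) x"
      using Leibniz_sum_Suc[of m "\<lambda>i. g i x" "\<lambda>i. F i x"] F_Suc[OF less.prems, of n] Suc by simp
    finally show ?thesis
      unfolding Suc
      by (rule has_field_derivative_transform_within_open[OF _ \<open>open S\<close> less.prems])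
         (simp add: F_Suc mult.assoc)
  qed
qed

text \<open>Equality with \<open>F n\<close> is needed on all of \<open>S\<close>, because the derivative at a point depends on
  nearby values.\<close>

lemma iterated_deriv_eqI:
  fixes F :: "nat \<Rightarrow> 'a :: real_normed_field \<Rightarrow> 'a"
  assumes F_deriv: "\<And>n x. x \<in> S \<Longrightarrow> (F n has_field_derivative F (Suc n) x) (at x)"
    and F_0: "\<And>x. x \<in> S \<Longrightarrow> f x = F 0 x"
    and "open S" "x \<in> S"
  shows "(deriv ^^ n) f x = F n x" and "(deriv ^^ n) f differentiable (at x)"
proof -
  have deriv_transfer: "(h has_field_derivative F (Suc n) x) (at x)"
    if "\<And>y. y \<in> S \<Longrightarrow> h y = F n y" "x \<in> S" for h n x
    using F_deriv[OF \<open>x \<in> S\<close>] \<open>open S\<close> \<open>x \<in> S\<close>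
    by (rule has_field_derivative_transform_within_open) (simp add: that)
  have eq: "(deriv ^^ n) f x = F n x" if "x \<in> S" for n x
    using that
  proof (induction n arbitrary: x)
    case 0
    then show ?case by (simp add: F_0)
  next
    case (Suc n)
    then show ?case
      using deriv_transfer[of "(deriv ^^ n) f" n x] by (simp add: DERIV_imp_deriv)
  qed
  show "(deriv ^^ n) f x = F n x"
    using eq \<open>x \<in> S\<close> by simp
  show "(deriv ^^ n) f differentiable (at x)"
    using deriv_transfer[of "(deriv ^^ n) f" n x] eq \<open>x \<in> S\<close>
    by (auto simp: differentiable_def has_field_derivative_def)
qed

section \<open>The recursion for \<open>\<Delta>\<close> as a Leibniz rule\<close>

text \<open>Both sides obey the same recursion, by Pascal's rule; the factor \<open>(- 1) ^ b * fact b\<close> is the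
  numerator of the \<open>(b + 1)\<close>-st derivative of \<open>ln\<close>.\<close>

lemma Omega_Suc_Suc: "Omega (Suc a) (Suc b) = (- 1) ^ b * fact b * int (a choose Suc b)"
proof (induction a arbitrary: b)
  case 0
  then show ?case by (subst Omega.simps) simp
next
  case (Suc a)
  show ?case
  proof (cases "b \<ge> Suc a")
    case True
    then show ?thesis by (subst Omega.simps) (simp add: binomial_eq_0)
  next
    case False
    show ?thesis
    proof (cases b)
      case 0
      then show ?thesis using Suc.IH[of 0] by (subst Omega.simps) simp
    next
      case (Suc c)
      then show ?thesis
        using False Suc.IH[of b] Suc.IH[of c]
        by (subst Omega.simps) (simp add: algebra_simps)
    qed
  qed
qed

text \<open>Here \<open>L\<close> stands for \<open>ln x\<close>; the identity is purely algebraic. Collecting the terms with fixed \<open>i\<close> in the recursion for \<open>\<Delta>\<close> turns the convolution into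
  complete logarithmic polynomials of lower order.\<close>

lemma Delta_sum_Suc:
  "(\<Sum>k\<le>Suc n. Delta (Suc n) k x * L ^ (Suc n - k)) =
   L * (\<Sum>k\<le>n. Delta n k x * L ^ (n - k)) +
   (\<Sum>i\<le>n. of_int (Omega (Suc n) i) / x ^ i * (\<Sum>k\<le>n - i. Delta (n - i) k x * L ^ (n - i - k)))"
proof -
  define t where "t i j = of_int (Omega (Suc n) i) / x ^ i * (Delta (n - i) j x * L ^ (n - i - j))" for i j
  have Delta_0: "Delta m 0 x = 1" for m
    by (subst Delta.simps) simp
  have rec: "Delta (Suc n) (Suc k) x * L ^ (n - k) =
             Delta n (Suc k) x * L ^ (n - k) + (\<Sum>i\<le>k. t i (k - i))" if "k \<le> n" for k
  proof -
    have "t i (k - i) = of_int (Omega (Suc n) i) * (1 / x ^ i) * Delta (n - i) (k - i) x * L ^ (n - k)"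
      if "i \<le> k" for i
      using that \<open>k \<le> n\<close> by (simp add: t_def)
    then show ?thesis
      using that by (subst Delta.simps) (simp add: distrib_right sum_distrib_right lessThan_Suc_atMost)
  qed
  have "(\<Sum>k\<le>Suc n. Delta (Suc n) k x * L ^ (Suc n - k)) =
        L ^ Suc n + (\<Sum>k\<le>n. Delta (Suc n) (Suc k) x * L ^ (n - k))"
    by (subst sum.atMost_Suc_shift) (simp add: Delta_0)
  also have "\<dots> = (L ^ Suc n + (\<Sum>k\<le>n. Delta n (Suc k) x * L ^ (n - k))) + (\<Sum>k\<le>n. \<Sum>i\<le>k. t i (k - i))"
    by (simp add: rec sum.distrib)
  also have "L ^ Suc n + (\<Sum>k\<le>n. Delta n (Suc k) x * L ^ (n - k)) =
             (\<Sum>k\<le>Suc n. Delta n k x * L ^ (Suc n - k))"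
    by (subst sum.atMost_Suc_shift) (simp add: Delta_0)
  \<comment> \<open>The term for \<open>k = Suc n\<close> vanishes, so every remaining term still contains a factor \<open>L\<close>.\<close>
  also have "\<dots> = L * (\<Sum>k\<le>n. Delta n k x * L ^ (n - k))"
  proof -
    have "Delta n (Suc n) x = 0"
      by (subst Delta.simps) simp
    then show ?thesis
      by (simp add: sum_distrib_left Suc_diff_le mult_ac)
  qed
  also have "(\<Sum>k\<le>n. \<Sum>i\<le>k. t i (k - i)) = (\<Sum>(i, j) \<in> {(i, j). i + j \<le> n}. t i j)"
    by (rule sum.triangle_reindex_eq[symmetric])
  also have "{(i, j). i + j \<le> n} = (SIGMA i:{..n}. {..n - i})"
    by auto
  also have "(\<Sum>(i, j) \<in> (SIGMA i:{..n}. {..n - i}). t i j) = (\<Sum>i\<le>n. \<Sum>j\<le>n - i. t i j)"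
    by (simp add: sum.Sigma)
  finally show ?thesis
    by (simp add: t_def sum_distrib_left)
qed

definition ln_plus_1_deriv :: "nat \<Rightarrow> real \<Rightarrow> real" where
  "ln_plus_1_deriv i x = (if i = 0 then ln x + 1 else (- 1) ^ (i - 1) * fact (i - 1) / x ^ i)"

lemma DERIV_ln_plus_1_deriv:
  assumes "x > 0"
  shows "(ln_plus_1_deriv i has_field_derivative ln_plus_1_deriv (Suc i) x) (at x)"
proof (cases i)
  case 0
  then show ?thesis
    using assms unfolding ln_plus_1_deriv_def by (auto intro!: derivative_eq_intros)
next
  case (Suc j)
  have "((\<lambda>x. (- 1) ^ j * fact j * inverse (x ^ Suc j)) has_field_derivative
         (- 1) ^ Suc j * fact (Suc j) / x ^ Suc (Suc j)) (at x)"
    using assms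
    by (auto intro!: derivative_eq_intros simp: field_simps simp del: power_Suc)
       (simp add: field_simps)
  then show ?thesis
    unfolding ln_plus_1_deriv_def Suc by (simp add: divide_inverse)
qed

lemma Omega_div_power_eq:
  "of_int (Omega (Suc n) i) / x ^ i =
   of_nat (n choose i) * ln_plus_1_deriv i x - (if i = 0 then ln x else 0)"
proof (cases i)
  case 0
  then show ?thesis
    by (subst Omega.simps) (simp add: ln_plus_1_deriv_def)
next
  case (Suc j)
  then show ?thesis
    by (simp add: ln_plus_1_deriv_def Omega_Suc_Suc)
qed

section \<open>The derivatives of \<open>x powr x\<close>\<close>

theorem proposition2p2:
  fixes n :: nat and x :: real
  assumes "n \<ge> 1" and "x > 0"
  shows "(\<forall>m<n. (deriv ^^ m) self_power differentiable (at x)) \<and>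
         (deriv ^^ n) self_power x =
           self_power x * (\<Sum>i=0..n. Delta n i x * ln x ^ (n - i))"
proof -
  define Q where "Q n x = (\<Sum>i\<le>n. Delta n i x * ln x ^ (n - i))" for n x
  define F where "F n x = self_power x * Q n x" for n x
  have Q_0: "Q 0 x = 1" for x
    unfolding Q_def by (subst Delta.simps) simp
  have Q_Suc: "Q (Suc n) x = (\<Sum>i\<le>n. of_nat (n choose i) * ln_plus_1_deriv i x * Q (n - i) x)" for n x
  proof -
    have "Q (Suc n) x = ln x * Q n x + (\<Sum>i\<le>n. of_int (Omega (Suc n) i) / x ^ i * Q (n - i) x)"
      unfolding Q_def by (rule Delta_sum_Suc)
    also have "(\<Sum>i\<le>n. of_int (Omega (Suc n) i) / x ^ i * Q (n - i) x) =
               (\<Sum>i\<le>n. of_nat (n choose i) * ln_plus_1_deriv i x * Q (n - i) x) -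
               (\<Sum>i\<le>n. if i = 0 then ln x * Q n x else 0)"
      unfolding Omega_div_power_eq left_diff_distrib sum_subtractf
      by (intro arg_cong2[where f = "(-)"] sum.cong) auto
    finally show ?thesis
      by simp
  qed
  have F_Suc: "F (Suc n) x = (\<Sum>i\<le>n. of_nat (n choose i) * ln_plus_1_deriv i x * F (n - i) x)" for n x
    by (simp add: F_def Q_Suc sum_distrib_left mult_ac)
  have F_0: "self_power = F 0"
    by (simp add: F_def Q_0 fun_eq_iff)
  have F_0_deriv: "(F 0 has_field_derivative F 1 x) (at x)" if "x \<in> {0<..}" for x
  proof -
    have "((\<lambda>x. exp (x * ln x)) has_field_derivative F 1 x) (at x)"
      using that F_Suc[of 0 x]
      by (auto intro!: derivative_eq_intros
          simp: F_0[symmetric] ln_plus_1_deriv_def self_power_def powr_def algebra_simps)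
    then have "(self_power has_field_derivative F 1 x) (at x)"
      by (rule has_field_derivative_transform_within_open[of _ _ _ "{0<..}"])
         (use that in \<open>auto simp: self_power_def powr_def\<close>)
    then show ?thesis
      unfolding F_0 .
  qed
  have F_deriv: "(F n has_field_derivative F (Suc n) x) (at x)" if "x \<in> {0<..}" for n x
    by (rule Leibniz_recursion_DERIV[where S = "{0<..}" and g = ln_plus_1_deriv, OF F_0_deriv _ F_Suc])
       (use that in \<open>auto simp: DERIV_ln_plus_1_deriv\<close>)
  note iterated = iterated_deriv_eqI[of "{0<..}" F self_power x, OF F_deriv]
  have "(deriv ^^ m) self_power differentiable (at x)" for m
    using \<open>x > 0\<close> by (intro iterated(2)) (auto simp: F_0)
  moreover have "(deriv ^^ n) self_power x = F n x"
    using \<open>x > 0\<close> by (intro iterated(1)) (auto simp: F_0)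
  ultimately show ?thesis
    by (simp add: F_def Q_def atLeast0AtMost)
qed

end
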